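(* Let $\mathfrak{h}$ be a Lie algebra, $\mathfrak{m}$ an $\mathfrak{h}$-module with representation $\rho:\mathfrak{h}\to\mathrm{End}(\mathfrak{m})$, and write $h\cdot u=\rho(h)u$. Consider brackets on $\mathfrak{g}=\mathfrak{h}\oplus\mathfrak{m}$ that extend the Lie bracket of $\mathfrak{h}$ and have the form $$[h,u]=\varphi(h,u)+h\cdot u,\qquad [u_1,u_2]=\theta_{\mathfrak{h}}(u_1,u_2)+\theta_{\mathfrak{m}}(u_1,u_2)\qquad (h\in\mathfrak{h},\ u,u_1,u_2\in\mathfrak{m}),$$ with $\varphi\in\mathfrak{h}^*\otimes\mathfrak{m}^*\otimes\mathfrak{h}$, $\theta_{\mathfrak{h}}\in\Lambda^2\mathfrak{m}^*\otimes\mathfrak{h}$, $\theta_{\mathfrak{m}}\in\Lambda^2\mathfrak{m}^*\otimes\mathfrak{m}$, where $d\varphi=0$, so that $\varphi$ defines a class $[\varphi]\in H^1(\mathfrak{h},\mathfrak{m}^*\otimes\mathfrak{h})$. Then the Jacobi identity with one argument from $\mathfrak{h}$ and the other two from $\mathfrak{m}$ gives the following constraints on the cohomology class $[\varphi]\in H^1(\mathfrak{h},\mathfrak{m}^*\otimes\mathfrak{h})$: (1) $[\delta\varphi]=0\in H^1(\mathfrak{h},\Lambda^2\mathfrak{m}^*\otimes\mathfrak{m})$, whence $\delta\varphi=d\theta_{\mathfrak{m}}$; (2) $[Q\varphi]\equiv 0\in H^1(\mathfrak{h},\Lambda^2\mathfrak{m}^*\otimes\mathfrak{h})$ modulo $\Pi_\varphi$,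 so $Q\varphi=d\theta_{\mathfrak{h}}$ for some choices of $\varphi,\theta_{\mathfrak{m}}$.
   Context: The spaces $\mathfrak{h}$ and $\mathfrak{m}$ are finite-dimensional. For an $\mathfrak{h}$-module $\mathbb{V}$, $d$ is the Lie algebra (Chevalley–Eilenberg) differential on $\Lambda^\bullet\mathfrak{h}^*\otimes\mathbb{V}$; in particular $(dv)(h)=h\cdot v$ for $v\in\mathbb{V}$ and $(d\omega)(h_1,h_2)=h_1\cdot\omega(h_2)-h_2\cdot\omega(h_1)-\omega([h_1,h_2])$ for $\omega\in\mathfrak{h}^*\otimes\mathbb{V}$. $Z^k$, $B^k$, $H^k(\mathfrak{h},\mathbb{V})$ denote its cocycles, coboundaries and cohomology. $\mathfrak{h}$ acts on itself by the adjoint action and on $\mathfrak{m}^*\otimes\mathfrak{h}$, $\Lambda^2\mathfrak{m}^*\otimes\mathfrak{m}$, $\Lambda^2\mathfrak{m}^*\otimes\mathfrak{h}$ by the induced actions; $\mathbb{V}^{\mathfrak{h}}$ denotes the $\mathfrak{h}$-invariants. The condition $d\varphi=0$ in the complex $\Lambda^\bullet\mathfrak{h}^*\otimes(\mathfrak{m}^*\otimes\mathfrak{h})$ is what the Jacobi identity with two arguments from $\mathfrak{h}$ and one from $\mathfrak{m}$ imposes on $\varphi$. Changing the complement $\mathfrak{m}\subset\mathfrak{g}$ to the graph of $\sigma\in\mathfrak{m}^*\otimes\mathfrak{h}$ changes $\varphi$ to $\varphi+d\sigma$. The linear operator $\delta$ is given by $$\delta\varphi(h)(u_1,u_2)=\varphi(h,u_1)\cdot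 u_2-\varphi(h,u_2)\cdot u_1,\qquad \delta\varphi\in\mathfrak{h}^*\otimes\Lambda^2\mathfrak{m}^*\otimes\mathfrak{m};$$ $d\varphi=0$ implies $d\delta\varphi=0$. Given $\theta_{\mathfrak{m}}\in\Lambda^2\mathfrak{m}^*\otimes\mathfrak{m}$ satisfying $\delta\varphi=d\theta_{\mathfrak{m}}$, the element $Q\varphi\in\mathfrak{h}^*\otimes\Lambda^2\mathfrak{m}^*\otimes\mathfrak{h}$ (which depends on $\theta_{\mathfrak{m}}$) is $$Q\varphi(h)(u_1,u_2)=\varphi(\varphi(h,u_1),u_2)-\varphi(\varphi(h,u_2),u_1)-\varphi(h,\theta_{\mathfrak{m}}(u_1,u_2));$$ it satisfies $d(Q\varphi)=0$. For $\nu\in(\Lambda^2\mathfrak{m}^*\otimes\mathfrak{m})^{\mathfrak{h}}$ put $p_\nu(h)(u_1,u_2)=\varphi(h,\nu(u_1,u_2))$; then $p_\nu\in Z^1(\mathfrak{h},\Lambda^2\mathfrak{m}^*\otimes\mathfrak{h})$. The subspace $\Pi_\varphi\subset H^1(\mathfrak{h},\Lambda^2\mathfrak{m}^*\otimes\mathfrak{h})$ is the image of $\{p_\nu:\nu\in(\Lambda^2\mathfrak{m}^*\otimes\mathfrak{m})^{\mathfrak{h}}\}$ modulo $B^1(\mathfrak{h},\Lambda^2\mathfrak{m}^*\otimes\mathfrak{h})$. *)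

theory Defs
  imports "HOL-Analysis.Product_Vector" "HOL-Library.Function_Algebras"
begin

text \<open>Vector spaces are whole types with an explicit scalar multiplication over an arbitrary field.
  Since the field may have characteristic 2, ``skew'' means alternating: the value vanishes
  on equal arguments. Tensor products such as \<open>m* \<otimes> h\<close> and \<open>\<Lambda>\<^sup>2m* \<otimes> h\<close> are
  realised (in finite dimension) as linear and as alternating bilinear maps; sums of maps are
  the pointwise ones.\<close>

definition bilinear_map ::
  "('k::field \<Rightarrow> 'a::ab_group_add \<Rightarrow> 'a) \<Rightarrow> ('k \<Rightarrow> 'b::ab_group_add \<Rightarrow> 'b) \<Rightarrow>
   ('k \<Rightarrow> 'c::ab_group_add \<Rightarrow> 'c) \<Rightarrow> ('a \<Rightarrow> 'b \<Rightarrow> 'c) \<Rightarrow> bool" where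
  "bilinear_map sa sb sc f \<longleftrightarrow>
     (\<forall>y. Vector_Spaces.linear sa sc (\<lambda>x. f x y)) \<and> (\<forall>x. Vector_Spaces.linear sb sc (f x))"

definition alternating_bilinear ::
  "('k::field \<Rightarrow> 'a::ab_group_add \<Rightarrow> 'a) \<Rightarrow> ('k \<Rightarrow> 'b::ab_group_add \<Rightarrow> 'b) \<Rightarrow>
   ('a \<Rightarrow> 'a \<Rightarrow> 'b) \<Rightarrow> bool" where
  "alternating_bilinear sa sb f \<longleftrightarrow> bilinear_map sa sa sb f \<and> (\<forall>x. f x x = 0)"

definition jacobiator :: "('a \<Rightarrow> 'a \<Rightarrow> 'a) \<Rightarrow> 'a \<Rightarrow> 'a \<Rightarrow> 'a \<Rightarrow> 'a::ab_group_add" where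
  "jacobiator b x y z = b x (b y z) + b y (b z x) + b z (b x y)"

locale lie_algebra = vector_space sh
  for sh :: "'k::field \<Rightarrow> 'h::ab_group_add \<Rightarrow> 'h" +
  fixes br :: "'h \<Rightarrow> 'h \<Rightarrow> 'h"
  assumes alternating_br: "alternating_bilinear sh sh br"
    and jacobi: "jacobiator br x y z = 0"

locale lie_representation = lie_algebra sh br + M: vector_space sm
  for sh :: "'k::field \<Rightarrow> 'h::ab_group_add \<Rightarrow> 'h" and br :: "'h \<Rightarrow> 'h \<Rightarrow> 'h"
    and sm :: "'k \<Rightarrow> 'm::ab_group_add \<Rightarrow> 'm" +
  fixes \<rho> :: "'h \<Rightarrow> 'm \<Rightarrow> 'm"
  assumes bilinear_rho: "bilinear_map sh sm sm \<rho>"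
    and rho_br: "\<rho> (br x y) u = \<rho> x (\<rho> y u) - \<rho> y (\<rho> x u)"

text \<open>Modules of maps: \<open>mod_space\<close> is a subspace of a type of functions.\<close>

record ('k, 'h, 'v) hmodule =
  mod_space :: "'v set"
  mod_scale :: "'k \<Rightarrow> 'v \<Rightarrow> 'v"
  mod_act :: "'h \<Rightarrow> 'v \<Rightarrow> 'v"

text \<open>For representations \<open>r\<close> on \<open>m\<close> and \<open>s\<close> on \<open>n\<close>: the induced modules
  \<open>m* \<otimes> n\<close> and \<open>\<Lambda>\<^sup>2m* \<otimes> n\<close>. The adjoint module is given by \<open>s = br\<close>.\<close>

definition Hom_mod ::
  "('k::field \<Rightarrow> 'm::ab_group_add \<Rightarrow> 'm) \<Rightarrow> ('h \<Rightarrow> 'm \<Rightarrow> 'm) \<Rightarrow>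
   ('k \<Rightarrow> 'n::ab_group_add \<Rightarrow> 'n) \<Rightarrow> ('h \<Rightarrow> 'n \<Rightarrow> 'n) \<Rightarrow> ('k, 'h, 'm \<Rightarrow> 'n) hmodule" where
  "Hom_mod sm r sn s =
    \<lparr> mod_space = {f. Vector_Spaces.linear sm sn f},
      mod_scale = (\<lambda>c f u. sn c (f u)),
      mod_act = (\<lambda>h f u. s h (f u) - f (r h u)) \<rparr>"

definition Alt2_mod ::
  "('k::field \<Rightarrow> 'm::ab_group_add \<Rightarrow> 'm) \<Rightarrow> ('h \<Rightarrow> 'm \<Rightarrow> 'm) \<Rightarrow>
   ('k \<Rightarrow> 'n::ab_group_add \<Rightarrow> 'n) \<Rightarrow> ('h \<Rightarrow> 'n \<Rightarrow> 'n) \<Rightarrow> ('k, 'h, 'm \<Rightarrow> 'm \<Rightarrow> 'n) hmodule" where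
  "Alt2_mod sm r sn s =
    \<lparr> mod_space = {f. alternating_bilinear sm sn f},
      mod_scale = (\<lambda>c f u1 u2. sn c (f u1 u2)),
      mod_act = (\<lambda>h f u1 u2. s h (f u1 u2) - f (r h u1) u2 - f u1 (r h u2)) \<rparr>"

definition invariants :: "('k, 'h, 'v::zero) hmodule \<Rightarrow> 'v set" where
  "invariants V = {v \<in> mod_space V. \<forall>h. mod_act V h v = 0}"

text \<open>The Chevalley-Eilenberg complex of \<open>h\<close> with values in \<open>V\<close> in degrees 0, 1, 2.\<close>

definition d0 :: "('k, 'h, 'v) hmodule \<Rightarrow> 'v \<Rightarrow> 'h \<Rightarrow> 'v" where
  "d0 V v = (\<lambda>h. mod_act V h v)"

definition d1 :: "('h \<Rightarrow> 'h \<Rightarrow> 'h) \<Rightarrow> ('k, 'h, 'v::ab_group_add) hmodule \<Rightarrow>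
    ('h \<Rightarrow> 'v) \<Rightarrow> 'h \<Rightarrow> 'h \<Rightarrow> 'v" where
  "d1 br V \<omega> = (\<lambda>h1 h2. mod_act V h1 (\<omega> h2) - mod_act V h2 (\<omega> h1) - \<omega> (br h1 h2))"

definition C1 :: "('k::field \<Rightarrow> 'h::ab_group_add \<Rightarrow> 'h) \<Rightarrow> ('k, 'h, 'v::ab_group_add) hmodule \<Rightarrow>
    ('h \<Rightarrow> 'v) set" where
  "C1 sh V = {\<omega>. Vector_Spaces.linear sh (mod_scale V) \<omega> \<and> range \<omega> \<subseteq> mod_space V}"

definition Z1 :: "('k::field \<Rightarrow> 'h::ab_group_add \<Rightarrow> 'h) \<Rightarrow> ('h \<Rightarrow> 'h \<Rightarrow> 'h) \<Rightarrow>
    ('k, 'h, 'v::ab_group_add) hmodule \<Rightarrow> ('h \<Rightarrow> 'v) set" where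
  "Z1 sh br V = {\<omega> \<in> C1 sh V. d1 br V \<omega> = 0}"

definition B1 :: "('k, 'h, 'v) hmodule \<Rightarrow> ('h \<Rightarrow> 'v) set" where
  "B1 V = d0 V ` mod_space V"

text \<open>Cohomology classes are cosets of \<open>B1 V\<close>; the zero class is \<open>coh_class V 0\<close>.\<close>

definition coh_class :: "('k, 'h, 'v::ab_group_add) hmodule \<Rightarrow> ('h \<Rightarrow> 'v) \<Rightarrow> ('h \<Rightarrow> 'v) set" where
  "coh_class V \<omega> = {\<omega> + \<beta> | \<beta>. \<beta> \<in> B1 V}"

definition H1 :: "('k::field \<Rightarrow> 'h::ab_group_add \<Rightarrow> 'h) \<Rightarrow> ('h \<Rightarrow> 'h \<Rightarrow> 'h) \<Rightarrow>
    ('k, 'h, 'v::ab_group_add) hmodule \<Rightarrow> ('h \<Rightarrow> 'v) set set" where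
  "H1 sh br V = coh_class V ` Z1 sh br V"

definition delta :: "('h \<Rightarrow> 'm \<Rightarrow> 'm::ab_group_add) \<Rightarrow> ('h \<Rightarrow> 'm \<Rightarrow> 'h) \<Rightarrow> 'h \<Rightarrow> 'm \<Rightarrow> 'm \<Rightarrow> 'm" where
  "delta \<rho> \<phi> = (\<lambda>h u1 u2. \<rho> (\<phi> h u1) u2 - \<rho> (\<phi> h u2) u1)"

definition Qop :: "('h::ab_group_add \<Rightarrow> 'm \<Rightarrow> 'h) \<Rightarrow> ('m \<Rightarrow> 'm \<Rightarrow> 'm) \<Rightarrow> 'h \<Rightarrow> 'm \<Rightarrow> 'm \<Rightarrow> 'h" where
  "Qop \<phi> \<theta>m = (\<lambda>h u1 u2. \<phi> (\<phi> h u1) u2 - \<phi> (\<phi> h u2) u1 - \<phi> h (\<theta>m u1 u2))"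

definition p_cocycle :: "('h \<Rightarrow> 'm \<Rightarrow> 'h) \<Rightarrow> ('m \<Rightarrow> 'm \<Rightarrow> 'm) \<Rightarrow> 'h \<Rightarrow> 'm \<Rightarrow> 'm \<Rightarrow> 'h" where
  "p_cocycle \<phi> \<nu> = (\<lambda>h u1 u2. \<phi> h (\<nu> u1 u2))"

text \<open>The subspace \<open>\<Pi>\<^sub>\<phi>\<close> of \<open>H\<^sup>1(h, \<Lambda>\<^sup>2m* \<otimes> h)\<close>. A class vanishes modulo \<open>\<Pi>\<^sub>\<phi>\<close> iff it
  lies in this set.\<close>

definition Pi_sub :: "('k::field \<Rightarrow> 'h::ab_group_add \<Rightarrow> 'h) \<Rightarrow> ('h \<Rightarrow> 'h \<Rightarrow> 'h) \<Rightarrow>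
    ('k \<Rightarrow> 'm::ab_group_add \<Rightarrow> 'm) \<Rightarrow> ('h \<Rightarrow> 'm \<Rightarrow> 'm) \<Rightarrow> ('h \<Rightarrow> 'm \<Rightarrow> 'h) \<Rightarrow>
    ('h \<Rightarrow> 'm \<Rightarrow> 'm \<Rightarrow> 'h) set set" where
  "Pi_sub sh br sm \<rho> \<phi> =
    coh_class (Alt2_mod sm \<rho> sh br) ` p_cocycle \<phi> ` invariants (Alt2_mod sm \<rho> sm \<rho>)"

end

theory Submission
  imports Defs
begin

text \<open>Expanding the Jacobi identity on \<open>(h, u\<^sub>1, u\<^sub>2)\<close> and separating its two components gives
  \<open>d\<theta>\<^sub>m = \<delta>\<phi>\<close> in \<open>m\<close> and \<open>d\<theta>\<^sub>h = Q\<phi>\<close> in \<open>h\<close> (\<open>jacobiator_G_hmm\<close>). What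
  remains is to see that these identities constrain the class of \<open>\<phi>\<close> and not only \<open>\<phi>\<close>.

  There are two choices to account for. A cocycle \<open>\<phi> + d\<sigma>\<close> in the same class belongs to the
  same bracket, written with the graph of \<open>\<sigma>\<close> in place of the complement \<open>m\<close>. Transporting the
  bracket along \<open>(h, u) \<mapsto> (h + \<sigma> u, u)\<close> therefore reproduces all hypotheses for
  \<open>\<phi> + d\<sigma>\<close> (\<open>change_of_complement\<close>), and nothing has to be computed for \<open>\<delta>\<close> and
  \<open>Q\<close> of the shifted cocycle. The one point to check is that the Jacobi identity also holds when
  the arguments from \<open>m\<close> acquire components in \<open>h\<close>; this is where \<open>d\<phi> = 0\<close> and the
  Jacobi identity of \<open>h\<close> enter (\<open>jacobi_h\<close>).

  The other choice is that of \<open>\<theta>\<^sub>m\<close> with \<open>d\<theta>\<^sub>m = \<delta>\<phi>\<close>. Two solutions differ by a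
  \<open>d\<close>-closed element of degree 0, that is, by an invariant \<open>\<nu>\<close>, and then \<open>Q\<phi>\<close> changes by
  \<open>p\<^sub>\<nu>\<close>, up to sign. As \<open>Q\<phi>\<close> is exact for the \<open>\<theta>\<^sub>m\<close> of the bracket, its class for any other choice
  lies in \<open>\<Pi>\<^sub>\<phi>\<close> (\<open>Q_class\<close>).\<close>

section \<open>Bilinear maps\<close>

lemma bilinear_mapI:
  assumes "vector_space sa" "vector_space sb" "vector_space sc"
    and "\<And>x x' y. f (x + x') y = f x y + f x' y" "\<And>c x y. f (sa c x) y = sc c (f x y)"
    and "\<And>x y y'. f x (y + y') = f x y + f x y'" "\<And>c x y. f x (sb c y) = sc c (f x y)"
  shows "bilinear_map sa sb sc f"
  using assms by (simp add: bilinear_map_def Vector_Spaces.linear_iff)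

lemma bilinear_map_simps:
  assumes "bilinear_map sa sb sc f"
  shows "f (x + x') y = f x y + f x' y" "f (x - x') y = f x y - f x' y" "f (- x) y = - f x y"
    "f 0 y = 0" "f (sa c x) y = sc c (f x y)"
    "f x (y + y') = f x y + f x y'" "f x (y - y') = f x y - f x y'" "f x (- y) = - f x y"
    "f x 0 = 0" "f x (sb c y) = sc c (f x y)"
proof -
  have "module_hom sa sc (\<lambda>x. f x y)" for y
    using assms by (simp add: bilinear_map_def module_hom_iff_linear)
  from module_hom.add[OF this] module_hom.diff[OF this] module_hom.neg[OF this]
    module_hom.zero[OF this] module_hom.scale[OF this]
  show "f (x + x') y = f x y + f x' y" "f (x - x') y = f x y - f x' y" "f (- x) y = - f x y"
    "f 0 y = 0" "f (sa c x) y = sc c (f x y)" by blast+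
  have "module_hom sb sc (f x)" for x
    using assms by (simp add: bilinear_map_def module_hom_iff_linear)
  from module_hom.add[OF this] module_hom.diff[OF this] module_hom.neg[OF this]
    module_hom.zero[OF this] module_hom.scale[OF this]
  show "f x (y + y') = f x y + f x y'" "f x (y - y') = f x y - f x y'" "f x (- y) = - f x y"
    "f x 0 = 0" "f x (sb c y) = sc c (f x y)" by blast+
qed

lemma alternating_bilinearI:
  assumes "vector_space sa" "vector_space sb"
    and "\<And>x x' y. f (x + x') y = f x y + f x' y" "\<And>c x y. f (sa c x) y = sb c (f x y)"
    and "\<And>x y y'. f x (y + y') = f x y + f x y'" "\<And>c x y. f x (sa c y) = sb c (f x y)"
    and "\<And>x. f x x = 0"
  shows "alternating_bilinear sa sb f"
  using assms by (auto simp: alternating_bilinear_def intro: bilinear_mapI)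

lemma alternating_bilinear_bilinear: "alternating_bilinear sa sb f \<Longrightarrow> bilinear_map sa sa sb f"
  by (simp add: alternating_bilinear_def)

lemmas alternating_bilinear_simps = bilinear_map_simps[OF alternating_bilinear_bilinear]

lemma alternating_bilinear_same: "alternating_bilinear sa sb f \<Longrightarrow> f x x = 0"
  by (simp add: alternating_bilinear_def)

lemma alternating_bilinear_swap:
  assumes "alternating_bilinear sa sb f"
  shows "f x y = - f y x"
proof -
  have "f x y + f y x = f (x + y) (x + y) - f x x - f y y"
    by (simp add: alternating_bilinear_simps(1,6)[OF assms] del: add_diff_cancel)
  then show ?thesis
    by (simp only: alternating_bilinear_same[OF assms] diff_zero eq_neg_iff_add_eq_0)
qed

section \<open>Modules over a Lie algebra and their cocycles\<close>

text \<open>Tensor modules live inside full function types, on which \<open>mod_act\<close> is additive in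
  the module argument but in general not in the Lie algebra argument; hence linearity in the latter is required
  on \<open>mod_space\<close> only.\<close>

locale lie_module = lie_algebra sh br + V: vector_space "mod_scale V"
  for sh :: "'k::field \<Rightarrow> 'h::ab_group_add \<Rightarrow> 'h" and br
    and V :: "('k, 'h, 'v::ab_group_add) hmodule" +
  assumes subspace_mod: "V.subspace (mod_space V)"
    and act_closed: "v \<in> mod_space V \<Longrightarrow> mod_act V h v \<in> mod_space V"
    and act_add: "mod_act V h (v + w) = mod_act V h v + mod_act V h w"
    and act_linear: "v \<in> mod_space V \<Longrightarrow> Vector_Spaces.linear sh (mod_scale V) (\<lambda>h. mod_act V h v)"
    and act_br: "v \<in> mod_space V \<Longrightarrow>
      mod_act V (br x y) v = mod_act V x (mod_act V y v) - mod_act V y (mod_act V x v)"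
begin

lemma Z1_add:
  assumes "\<omega> \<in> Z1 sh br V" "\<eta> \<in> Z1 sh br V" shows "\<omega> + \<eta> \<in> Z1 sh br V"
proof -
  have lin: "Vector_Spaces.linear sh (mod_scale V) \<omega>" "Vector_Spaces.linear sh (mod_scale V) \<eta>"
    and mem: "\<omega> h \<in> mod_space V" "\<eta> h \<in> mod_space V"
    and d: "d1 br V \<omega> = 0" "d1 br V \<eta> = 0" for h
    using assms by (auto simp: Z1_def C1_def)
  have "Vector_Spaces.linear sh (mod_scale V) (\<lambda>h. \<omega> h + \<eta> h)"
    using lin by (simp add: Vector_Spaces.linear_iff V.scale_right_distrib add_ac)
  then have "Vector_Spaces.linear sh (mod_scale V) (\<omega> + \<eta>)"
    by (simp add: plus_fun_def)
  moreover have "(\<omega> + \<eta>) h \<in> mod_space V" for h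
    using V.subspace_add[OF subspace_mod mem] by simp
  moreover have "d1 br V (\<omega> + \<eta>) = d1 br V \<omega> + d1 br V \<eta>"
    by (simp add: d1_def act_add fun_eq_iff)
  ultimately show ?thesis by (auto simp: Z1_def C1_def d)
qed

lemma B1_subset_Z1: "B1 V \<subseteq> Z1 sh br V"
proof
  fix \<omega> assume "\<omega> \<in> B1 V"
  then obtain v where v: "v \<in> mod_space V" and \<omega>: "\<omega> = (\<lambda>h. mod_act V h v)"
    by (auto simp: B1_def d0_def)
  have "d1 br V \<omega> = 0"
    unfolding d1_def \<omega> act_br[OF v] by (simp add: fun_eq_iff)
  then show "\<omega> \<in> Z1 sh br V"
    using act_linear[OF v] act_closed[OF v] by (auto simp: Z1_def C1_def \<omega>)
qed

lemma act_additive: "additive (mod_act V h)"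
  by unfold_locales (rule act_add)

lemma d0_add: "d0 V (v + w) = d0 V v + d0 V w"
  by (simp add: d0_def act_add fun_eq_iff)

lemma d0_diff: "d0 V (v - w) = d0 V v - d0 V w"
  by (simp add: d0_def additive.diff[OF act_additive] fun_eq_iff)

lemma B1_add: "\<beta> \<in> B1 V \<Longrightarrow> \<gamma> \<in> B1 V \<Longrightarrow> \<beta> + \<gamma> \<in> B1 V"
  unfolding B1_def using V.subspace_add[OF subspace_mod] by (auto simp: d0_add[symmetric])

lemma B1_diff: "\<beta> \<in> B1 V \<Longrightarrow> \<gamma> \<in> B1 V \<Longrightarrow> \<beta> - \<gamma> \<in> B1 V"
  unfolding B1_def using V.subspace_diff[OF subspace_mod] by (auto simp: d0_diff[symmetric])

lemma coh_class_add_B1: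
  assumes "\<beta> \<in> B1 V" shows "coh_class V (\<omega> + \<beta>) = coh_class V \<omega>"
proof (intro subset_antisym subsetI)
  fix \<eta> assume "\<eta> \<in> coh_class V (\<omega> + \<beta>)"
  then obtain \<gamma> where "\<gamma> \<in> B1 V" "\<eta> = \<omega> + (\<beta> + \<gamma>)" by (auto simp: coh_class_def add.assoc)
  then show "\<eta> \<in> coh_class V \<omega>" using B1_add[OF assms] by (auto simp: coh_class_def)
next
  fix \<eta> assume "\<eta> \<in> coh_class V \<omega>"
  then obtain \<gamma> where "\<gamma> \<in> B1 V" "\<eta> = (\<omega> + \<beta>) + (\<gamma> - \<beta>)"
    by (auto simp: coh_class_def)
  then show "\<eta> \<in> coh_class V (\<omega> + \<beta>)"
    using B1_diff[OF _ assms] unfolding coh_class_def by blast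
qed

end

lemma (in lie_algebra) br_br: "br (br x y) z = br x (br y z) - br y (br x z)"
proof -
  have "br y (br z x) = - br y (br x z)" "br z (br x y) = - br (br x y) z"
    using alternating_bilinear_swap[OF alternating_br, of z x]
      alternating_bilinear_swap[OF alternating_br, of z "br x y"]
    by (auto simp: alternating_bilinear_simps[OF alternating_br])
  then show ?thesis using jacobi[of x y z] by (simp add: jacobiator_def algebra_simps)
qed

lemma (in lie_algebra) adjoint_representation: "lie_representation sh br sh br"
  using br_br alternating_br
  by unfold_locales (auto intro: alternating_bilinear_bilinear)


lemma mod_space_Hom_mod: "mod_space (Hom_mod sm r sn s) = {f. Vector_Spaces.linear sm sn f}"
  by (simp add: Hom_mod_def)

lemma vector_space_fun: "vector_space sn \<Longrightarrow> vector_space (\<lambda>c f u. sn c (f u))"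
  by (simp add: vector_space_def fun_eq_iff)

lemma (in lie_representation) Hom_lie_module:
  assumes N: "lie_representation sh br sn \<tau>"
  shows "lie_module sh br (Hom_mod sm \<rho> sn \<tau>)" (is "lie_module sh br ?V")
proof -
  interpret N: lie_representation sh br sn \<tau> by fact
  note simps = bilinear_map_simps[OF bilinear_rho] bilinear_map_simps[OF N.bilinear_rho]
    rho_br N.rho_br
  have lin: "f (u + v) = f u + f v" "f (u - v) = f u - f v" "f (sm c u) = sn c (f u)"
    if "f \<in> mod_space ?V" for f u v c
    using that by (simp_all add: Hom_mod_def module_hom.add module_hom.diff module_hom.scale
        flip: module_hom_iff_linear)
  have mem: "f \<in> mod_space ?V \<longleftrightarrow> (\<forall>u v. f (u + v) = f u + f v) \<and> (\<forall>c u. f (sm c u) = sn c (f u))"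
    for f by (simp add: Hom_mod_def Vector_Spaces.linear_iff M.vector_space_axioms N.M.vector_space_axioms)
  have scale: "mod_scale ?V = (\<lambda>c f u. sn c (f u))" by (simp add: Hom_mod_def)
  have act: "mod_act ?V = (\<lambda>h f u. \<tau> h (f u) - f (\<rho> h u))" by (simp add: Hom_mod_def)
  interpret V: vector_space "mod_scale ?V"
    unfolding scale by (rule vector_space_fun) (rule N.M.vector_space_axioms)
  show ?thesis
  proof (intro lie_module.intro lie_module_axioms.intro lie_algebra_axioms V.vector_space_axioms)
    show "V.subspace (mod_space ?V)"
      unfolding V.subspace_def Ball_def mem
      by (simp add: scale N.M.scale_right_distrib N.M.scale_left_commute algebra_simps)
    show "mod_act ?V h f \<in> mod_space ?V" if "f \<in> mod_space ?V" for f h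
      unfolding mem by (simp add: act lin[OF that] simps N.M.scale_right_diff_distrib algebra_simps)
    show "mod_act ?V h (f + g) = mod_act ?V h f + mod_act ?V h g" for h f g
      by (simp add: act fun_eq_iff simps)
    show "Vector_Spaces.linear sh (mod_scale ?V) (\<lambda>h. mod_act ?V h f)" if "f \<in> mod_space ?V" for f
      unfolding Vector_Spaces.linear_iff
      by (intro conjI allI vector_space_axioms V.vector_space_axioms)
        (simp_all add: act scale fun_eq_iff simps lin[OF that] N.M.scale_right_diff_distrib)
    show "mod_act ?V (br x y) f = mod_act ?V x (mod_act ?V y f) - mod_act ?V y (mod_act ?V x f)"
      if "f \<in> mod_space ?V" for x y f
      by (simp add: act fun_eq_iff simps lin[OF that])
  qed
qed

lemma (in lie_representation) Alt2_lie_module: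
  assumes N: "lie_representation sh br sn \<tau>"
  shows "lie_module sh br (Alt2_mod sm \<rho> sn \<tau>)" (is "lie_module sh br ?V")
proof -
  interpret N: lie_representation sh br sn \<tau> by fact
  note simps = bilinear_map_simps[OF bilinear_rho] bilinear_map_simps[OF N.bilinear_rho]
    rho_br N.rho_br
  have mem: "f \<in> mod_space ?V \<longleftrightarrow> alternating_bilinear sm sn f" for f
    by (simp add: Alt2_mod_def)
  have scale: "mod_scale ?V = (\<lambda>c f u v. sn c (f u v))" by (simp add: Alt2_mod_def)
  have act: "mod_act ?V = (\<lambda>h f u v. \<tau> h (f u v) - f (\<rho> h u) v - f u (\<rho> h v))"
    by (simp add: Alt2_mod_def)
  interpret V: vector_space "mod_scale ?V"
    unfolding scale by (intro vector_space_fun) (rule N.M.vector_space_axioms)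
  show ?thesis
  proof (intro lie_module.intro lie_module_axioms.intro lie_algebra_axioms V.vector_space_axioms)
    note alt = alternating_bilinear_simps alternating_bilinear_same
    show "V.subspace (mod_space ?V)"
      unfolding V.subspace_def Ball_def mem
      by (auto intro!: alternating_bilinearI M.vector_space_axioms N.M.vector_space_axioms
          simp: alt scale N.M.scale_right_distrib N.M.scale_left_commute add_ac)
    show "mod_act ?V h f \<in> mod_space ?V" if "f \<in> mod_space ?V" for f h
    proof -
      have f: "alternating_bilinear sm sn f" using that by (simp add: mem)
      have swap: "f (\<rho> h u) u = - f u (\<rho> h u)" for u
        by (rule alternating_bilinear_swap[OF f])
      show ?thesis unfolding mem
        by (rule alternating_bilinearI[OF M.vector_space_axioms N.M.vector_space_axioms])
          (simp_all add: act alt[OF f] simps N.M.scale_right_diff_distrib swap algebra_simps)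
    qed
    show "mod_act ?V h (f + g) = mod_act ?V h f + mod_act ?V h g" for h f g
      by (simp add: act fun_eq_iff simps)
    fix f assume "f \<in> mod_space ?V"
    then have f: "alternating_bilinear sm sn f" by (simp add: mem)
    show "Vector_Spaces.linear sh (mod_scale ?V) (\<lambda>h. mod_act ?V h f)"
      unfolding Vector_Spaces.linear_iff
      by (intro conjI allI vector_space_axioms V.vector_space_axioms)
        (simp_all add: act scale fun_eq_iff simps alt[OF f] N.M.scale_right_diff_distrib)
    show "mod_act ?V (br x y) f = mod_act ?V x (mod_act ?V y f) - mod_act ?V y (mod_act ?V x f)"
      for x y
      by (simp add: act fun_eq_iff simps alt[OF f])
  qed
qed

lemma linear_fun_iff:
  assumes "vector_space sn"
  shows "Vector_Spaces.linear sh (\<lambda>c f u. sn c (f u)) \<omega> \<longleftrightarrow>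
    (\<forall>u. Vector_Spaces.linear sh sn (\<lambda>h. \<omega> h u))"
  by (auto simp: Vector_Spaces.linear_iff fun_eq_iff assms vector_space_fun[OF assms])

lemma C1_Hom_mod_iff:
  assumes "vector_space sn"
  shows "\<omega> \<in> C1 sh (Hom_mod sm \<rho> sn \<tau>) \<longleftrightarrow> bilinear_map sh sm sn \<omega>"
  by (auto simp: C1_def Hom_mod_def bilinear_map_def linear_fun_iff[OF assms])

text \<open>Composing with an invariant \<open>\<nu>\<close> commutes with the action of \<open>h\<close>, hence with the
  differential: \<open>d p\<^sub>\<nu>(h, k)(u, v) = d\<phi>(h, k)(\<nu>(u, v)) = 0\<close>.\<close>

lemma (in lie_representation) p_cocycle_Z1:
  assumes phi: "\<phi> \<in> Z1 sh br (Hom_mod sm \<rho> sh br)"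
    and nu: "\<nu> \<in> invariants (Alt2_mod sm \<rho> sm \<rho>)"
  shows "p_cocycle \<phi> \<nu> \<in> Z1 sh br (Alt2_mod sm \<rho> sh br)"
proof -
  have bil: "bilinear_map sh sm sh \<phi>"
    using phi by (simp add: Z1_def C1_Hom_mod_iff[OF vector_space_axioms])
  note phi_simps = bilinear_map_simps[OF bil]
  have alt: "alternating_bilinear sm sm \<nu>"
    and inv: "\<nu> (\<rho> h u) v + \<nu> u (\<rho> h v) = \<rho> h (\<nu> u v)" for h u v
    using nu by (auto simp: invariants_def Alt2_mod_def fun_eq_iff algebra_simps)
  have d\<phi>: "br h (\<phi> k u) - \<phi> k (\<rho> h u) - (br k (\<phi> h u) - \<phi> h (\<rho> k u)) = \<phi> (br h k) u" for h k u
    using phi by (auto simp: Z1_def d1_def Hom_mod_def fun_eq_iff)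
  have "p_cocycle \<phi> \<nu> \<in> C1 sh (Alt2_mod sm \<rho> sh br)"
    unfolding C1_def p_cocycle_def
    by (auto simp: Alt2_mod_def Vector_Spaces.linear_iff fun_eq_iff phi_simps vector_space_axioms
        alternating_bilinear_simps[OF alt] alternating_bilinear_same[OF alt]
        intro!: vector_space_fun alternating_bilinearI M.vector_space_axioms)
  moreover have "d1 br (Alt2_mod sm \<rho> sh br) (p_cocycle \<phi> \<nu>) h k u v = 0" for h k u v
  proof -
    have "\<phi> k (\<nu> (\<rho> h u) v) + \<phi> k (\<nu> u (\<rho> h v)) = \<phi> k (\<rho> h (\<nu> u v))" for h k
      by (simp only: phi_simps(6)[symmetric] inv)
    from this[of k h] this[of h k] d\<phi>[of h k "\<nu> u v"] show ?thesis
      by (simp add: d1_def Alt2_mod_def p_cocycle_def algebra_simps)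
  qed
  ultimately show ?thesis by (simp add: Z1_def fun_eq_iff)
qed

section \<open>Brackets extending a representation\<close>

lemma jacobiator_swap:
  assumes "alternating_bilinear sa sa b"
  shows "jacobiator b x z y = - jacobiator b x y z"
proof -
  have "b x (b z y) = - b x (b y z)" "b z (b y x) = - b z (b x y)" "b y (b x z) = - b y (b z x)"
    using alternating_bilinear_swap[OF assms, of z y] alternating_bilinear_swap[OF assms, of y x]
      alternating_bilinear_swap[OF assms, of x z]
    by (simp_all add: alternating_bilinear_simps[OF assms])
  then show ?thesis by (simp add: jacobiator_def)
qed

lemma jacobiator_add_right:
  assumes "alternating_bilinear sa sa b"
  shows "jacobiator b x y (z + z') = jacobiator b x y z + jacobiator b x y z'"
  by (simp add: jacobiator_def alternating_bilinear_simps[OF assms])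

lemma jacobiator_add_middle:
  assumes "alternating_bilinear sa sa b"
  shows "jacobiator b x (y + y') z = jacobiator b x y z + jacobiator b x y' z"
  by (simp add: jacobiator_def alternating_bilinear_simps[OF assms])

text \<open>The forms \<open>\<theta>\<^sub>h\<close> and \<open>\<theta>\<^sub>m\<close> are read off from \<open>G\<close>, so that the structure depends
  only on \<open>G\<close> and \<open>\<phi>\<close> and a change of complement needs no formula for the new forms.\<close>

locale bracket_extension = lie_representation sh br sm \<rho>
  for sh :: "'k::field \<Rightarrow> 'h::ab_group_add \<Rightarrow> 'h" and br
    and sm :: "'k \<Rightarrow> 'm::ab_group_add \<Rightarrow> 'm" and \<rho> +
  fixes G :: "'h \<times> 'm \<Rightarrow> 'h \<times> 'm \<Rightarrow> 'h \<times> 'm" and \<phi> :: "'h \<Rightarrow> 'm \<Rightarrow> 'h"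
  assumes alternating_G:
      "alternating_bilinear (module_prod.scale sh sm) (module_prod.scale sh sm) G"
    and phi_Z1: "\<phi> \<in> Z1 sh br (Hom_mod sm \<rho> sh br)"
    and G_hh: "G (h, 0) (k, 0) = (br h k, 0)"
    and G_hm: "G (h, 0) (0, u) = (\<phi> h u, \<rho> h u)"
    and jacobi_hmm: "jacobiator G (h, 0) (0, u) (0, v) = 0"
begin

sublocale P: vector_space_prod sh sm ..

definition theta_h :: "'m \<Rightarrow> 'm \<Rightarrow> 'h" where "theta_h u v = fst (G (0, u) (0, v))"

definition theta_m :: "'m \<Rightarrow> 'm \<Rightarrow> 'm" where "theta_m u v = snd (G (0, u) (0, v))"

lemmas G_simps = alternating_bilinear_simps[OF alternating_G]

lemma G_mm_bilinear:
  "G (0, u + u') (0, v) = G (0, u) (0, v) + G (0, u') (0, v)"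
  "G (0, sm c u) (0, v) = P.scale c (G (0, u) (0, v))"
  "G (0, u) (0, v + v') = G (0, u) (0, v) + G (0, u) (0, v')"
  "G (0, u) (0, sm c v) = P.scale c (G (0, u) (0, v))"
  using G_simps(1)[of "(0, u)" "(0, u')" "(0, v)"] G_simps(5)[of c "(0, u)" "(0, v)"]
    G_simps(6)[of "(0, u)" "(0, v)" "(0, v')"] G_simps(10)[of "(0, u)" c "(0, v)"]
  by (simp_all add: P.scale_prod)

lemma alternating_theta_h: "alternating_bilinear sm sh theta_h"
  by (rule alternating_bilinearI[OF M.vector_space_axioms vector_space_axioms])
    (simp_all add: theta_h_def G_mm_bilinear P.scale_def alternating_bilinear_same[OF alternating_G])

lemma alternating_theta_m: "alternating_bilinear sm sm theta_m"
  by (rule alternating_bilinearI[OF M.vector_space_axioms M.vector_space_axioms])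
    (simp_all add: theta_m_def G_mm_bilinear P.scale_def alternating_bilinear_same[OF alternating_G])

lemma bilinear_phi: "bilinear_map sh sm sh \<phi>"
  using phi_Z1 by (simp add: Z1_def C1_Hom_mod_iff[OF vector_space_axioms])

lemma phi_br: "\<phi> (br h k) u = br h (\<phi> k u) - \<phi> k (\<rho> h u) - (br k (\<phi> h u) - \<phi> h (\<rho> k u))"
  using phi_Z1 by (simp add: Z1_def d1_def Hom_mod_def fun_eq_iff)

lemmas op_simps = bilinear_map_simps[OF bilinear_phi] bilinear_map_simps[OF bilinear_rho]
  alternating_bilinear_simps[OF alternating_br] alternating_bilinear_simps[OF alternating_theta_h]
  alternating_bilinear_simps[OF alternating_theta_m]

lemma G_eq:
  "G (h, u) (k, v) = (br h k + \<phi> h v - \<phi> k u + theta_h u v, \<rho> h v - \<rho> k u + theta_m u v)"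
proof -
  have "G (h, u) (k, v) = G ((h, 0) + (0, u)) ((k, 0) + (0, v))" by simp
  also have "\<dots> = G (h, 0) (k, 0) + G (h, 0) (0, v) + G (0, u) (k, 0) + G (0, u) (0, v)"
    by (simp only: G_simps add_ac)
  also have "G (0, u) (k, 0) = - G (k, 0) (0, u)"
    by (rule alternating_bilinear_swap[OF alternating_G])
  finally show ?thesis
    by (simp add: G_hh G_hm prod_eq_iff theta_h_def theta_m_def)
qed

text \<open>The terms \<open>[u\<^sub>2, [h, u\<^sub>1]]\<close> and \<open>[u\<^sub>1, [u\<^sub>2, h]]\<close> supply both the action of \<open>h\<close> on
  the arguments of \<open>\<theta>\<close> and the quadratic terms in \<open>\<phi>\<close>.\<close>

lemma jacobiator_G_hmm:
  "jacobiator G (h, 0) (0, u) (0, v) =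
    (d0 (Alt2_mod sm \<rho> sh br) theta_h h u v - Qop \<phi> theta_m h u v,
     d0 (Alt2_mod sm \<rho> sm \<rho>) theta_m h u v - delta \<rho> \<phi> h u v)"
  using alternating_bilinear_swap[OF alternating_theta_h, of v "\<rho> h u"]
    alternating_bilinear_swap[OF alternating_theta_m, of v "\<rho> h u"]
  by (simp add: jacobiator_def G_eq op_simps d0_def Alt2_mod_def Qop_def delta_def prod_eq_iff
      algebra_simps)

lemma delta_eq_d_theta_m: "delta \<rho> \<phi> = d0 (Alt2_mod sm \<rho> sm \<rho>) theta_m"
  using jacobi_hmm by (auto simp: jacobiator_G_hmm fun_eq_iff prod_eq_iff)

lemma Q_eq_d_theta_h: "Qop \<phi> theta_m = d0 (Alt2_mod sm \<rho> sh br) theta_h"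
  using jacobi_hmm by (auto simp: jacobiator_G_hmm fun_eq_iff prod_eq_iff)

sublocale Mod_m: lie_module sh br "Alt2_mod sm \<rho> sm \<rho>"
  by (rule Alt2_lie_module) (rule lie_representation_axioms)

sublocale Mod_h: lie_module sh br "Alt2_mod sm \<rho> sh br"
  by (rule Alt2_lie_module) (rule adjoint_representation)

lemma delta_class:
  "coh_class (Alt2_mod sm \<rho> sm \<rho>) (delta \<rho> \<phi>) \<in> H1 sh br (Alt2_mod sm \<rho> sm \<rho>)"
  "coh_class (Alt2_mod sm \<rho> sm \<rho>) (delta \<rho> \<phi>) = coh_class (Alt2_mod sm \<rho> sm \<rho>) 0"
proof -
  have B1: "delta \<rho> \<phi> \<in> B1 (Alt2_mod sm \<rho> sm \<rho>)"
    using alternating_theta_m by (simp add: delta_eq_d_theta_m B1_def Alt2_mod_def)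
  then show "coh_class (Alt2_mod sm \<rho> sm \<rho>) (delta \<rho> \<phi>) \<in> H1 sh br (Alt2_mod sm \<rho> sm \<rho>)"
    using Mod_m.B1_subset_Z1 by (auto simp: H1_def)
  show "coh_class (Alt2_mod sm \<rho> sm \<rho>) (delta \<rho> \<phi>) = coh_class (Alt2_mod sm \<rho> sm \<rho>) 0"
    using Mod_m.coh_class_add_B1[OF B1, of 0] by simp
qed

lemma Q_class:
  assumes theta: "\<theta> \<in> mod_space (Alt2_mod sm \<rho> sm \<rho>)"
    and d_theta: "delta \<rho> \<phi> = d0 (Alt2_mod sm \<rho> sm \<rho>) \<theta>"
  shows "coh_class (Alt2_mod sm \<rho> sh br) (Qop \<phi> \<theta>) \<in> H1 sh br (Alt2_mod sm \<rho> sh br)"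
    and "coh_class (Alt2_mod sm \<rho> sh br) (Qop \<phi> \<theta>) \<in> Pi_sub sh br sm \<rho> \<phi>"
proof -
  (* The sign is chosen so that Q for the given form is Q for theta_m plus p_nu: the last term
     of Q enters negatively. *)
  define \<nu> where "\<nu> = theta_m - \<theta>"
  have "d0 (Alt2_mod sm \<rho> sm \<rho>) \<nu> = 0"
    by (simp add: \<nu>_def Mod_m.d0_diff flip: d_theta delta_eq_d_theta_m)
  moreover have "\<nu> \<in> mod_space (Alt2_mod sm \<rho> sm \<rho>)"
    unfolding \<nu>_def using theta alternating_theta_m
    by (intro Mod_m.V.subspace_diff Mod_m.subspace_mod) (simp_all add: Alt2_mod_def)
  ultimately have inv: "\<nu> \<in> invariants (Alt2_mod sm \<rho> sm \<rho>)"
    by (simp add: invariants_def d0_def fun_eq_iff)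
  have Q: "Qop \<phi> \<theta> = p_cocycle \<phi> \<nu> + d0 (Alt2_mod sm \<rho> sh br) theta_h"
    by (simp add: Q_eq_d_theta_h[symmetric] Qop_def p_cocycle_def \<nu>_def fun_eq_iff op_simps)
  have "d0 (Alt2_mod sm \<rho> sh br) theta_h \<in> B1 (Alt2_mod sm \<rho> sh br)"
    using alternating_theta_h by (simp add: B1_def Alt2_mod_def)
  then have class_eq: "coh_class (Alt2_mod sm \<rho> sh br) (Qop \<phi> \<theta>) =
      coh_class (Alt2_mod sm \<rho> sh br) (p_cocycle \<phi> \<nu>)"
    unfolding Q by (rule Mod_h.coh_class_add_B1)
  show "coh_class (Alt2_mod sm \<rho> sh br) (Qop \<phi> \<theta>) \<in> H1 sh br (Alt2_mod sm \<rho> sh br)"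
    unfolding class_eq H1_def by (intro imageI p_cocycle_Z1 phi_Z1 inv)
  show "coh_class (Alt2_mod sm \<rho> sh br) (Qop \<phi> \<theta>) \<in> Pi_sub sh br sm \<rho> \<phi>"
    unfolding class_eq Pi_sub_def by (intro imageI inv)
qed

text \<open>Trilinearity splits the Jacobi identity into types \<open>hhh\<close>, \<open>hhm\<close>, \<open>hmh\<close> and
  \<open>hmm\<close>. The first is the Jacobi identity of \<open>h\<close>; the second has component
  \<open>d\<phi> = 0\<close> in \<open>h\<close> and the representation property in \<open>m\<close>; the third follows from the
  second by skew symmetry.\<close>

lemma jacobi_h: "jacobiator G (h, 0) (k, u) (l, v) = 0"
proof -
  have hhh: "jacobiator G (h, 0) (k, 0) (l, 0) = 0" for k l
    using jacobi[of h k l] by (simp add: jacobiator_def G_hh zero_prod_def)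
  have hhm: "jacobiator G (h, 0) (k, 0) (0, v) = 0" for k v
    by (simp add: jacobiator_def G_eq op_simps phi_br rho_br zero_prod_def)
  have hmh: "jacobiator G (h, 0) (0, u) (l, 0) = 0" for l u
    using jacobiator_swap[OF alternating_G, of "(h, 0)" "(0, u)" "(l, 0)"] by (simp add: hhm)
  have "jacobiator G (h, 0) (k, u) (l, v) =
      jacobiator G (h, 0) ((k, 0) + (0, u)) ((l, 0) + (0, v))" by simp
  also have "\<dots> = 0"
    by (simp only: jacobiator_add_right[OF alternating_G] jacobiator_add_middle[OF alternating_G]
        hhh hhm hmh jacobi_hmm add_0)
  finally show ?thesis .
qed

text \<open>\<open>T\<close> sends \<open>m\<close> to the graph of \<open>\<sigma>\<close> and is the identity on \<open>h\<close>; \<open>S\<close> is its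
  inverse.\<close>

lemma change_of_complement:
  assumes sigma: "Vector_Spaces.linear sm sh \<sigma>"
  defines "T \<equiv> \<lambda>x. (fst x + \<sigma> (snd x), snd x)" and "S \<equiv> \<lambda>x. (fst x - \<sigma> (snd x), snd x)"
  shows "bracket_extension sh br sm \<rho> (\<lambda>x y. S (G (T x) (T y))) (\<phi> + d0 (Hom_mod sm \<rho> sh br) \<sigma>)"
proof -
  have sigma_hom: "module_hom sm sh \<sigma>" using sigma by (simp add: module_hom_iff_linear)
  note sigma_simps = module_hom.add[OF sigma_hom] module_hom.diff[OF sigma_hom]
    module_hom.scale[OF sigma_hom] module_hom.zero[OF sigma_hom]
  have T_simps: "T (x + y) = T x + T y" "T (P.scale c x) = P.scale c (T x)" for x y c
    by (simp_all add: T_def P.scale_def sigma_simps scale_right_distrib)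
  have S_simps: "S (x + y) = S x + S y" "S (P.scale c x) = P.scale c (S x)" "S 0 = 0"
    and TS: "T (S x) = x" for x y c
    by (simp_all add: T_def S_def P.scale_def sigma_simps scale_right_diff_distrib zero_prod_def)
  interpret Hom: lie_module sh br "Hom_mod sm \<rho> sh br"
    by (rule Hom_lie_module) (rule adjoint_representation)
  show ?thesis
  proof (intro bracket_extension.intro bracket_extension_axioms.intro lie_representation_axioms)
    show "alternating_bilinear P.scale P.scale (\<lambda>x y. S (G (T x) (T y)))"
      by (rule alternating_bilinearI[OF P.p.vector_space_axioms P.p.vector_space_axioms])
        (simp_all add: T_simps S_simps G_simps alternating_bilinear_same[OF alternating_G])
    have "\<sigma> \<in> mod_space (Hom_mod sm \<rho> sh br)" using sigma by (simp add: Hom_mod_def)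
    then show "\<phi> + d0 (Hom_mod sm \<rho> sh br) \<sigma> \<in> Z1 sh br (Hom_mod sm \<rho> sh br)"
      using Hom.B1_subset_Z1 by (intro Hom.Z1_add phi_Z1) (auto simp: B1_def)
  next
    fix h k u v
    show "S (G (T (h, 0)) (T (k, 0))) = (br h k, 0)"
      by (simp add: T_def S_def G_hh sigma_simps)
    show "S (G (T (h, 0)) (T (0, u))) = ((\<phi> + d0 (Hom_mod sm \<rho> sh br) \<sigma>) h u, \<rho> h u)"
      by (simp add: T_def S_def G_eq sigma_simps op_simps d0_def Hom_mod_def)
    have "jacobiator (\<lambda>x y. S (G (T x) (T y))) (h, 0) (0, u) (0, v) =
        S (jacobiator G (T (h, 0)) (T (0, u)) (T (0, v)))"
      by (simp only: jacobiator_def TS S_simps)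
    also have "\<dots> = 0"
      by (simp add: T_def sigma_simps jacobi_h S_simps(3))
    finally show "jacobiator (\<lambda>x y. S (G (T x) (T y))) (h, 0) (0, u) (0, v) = 0" .
  qed
qed

end

theorem theorem1:
  fixes sh :: "'k::field \<Rightarrow> 'h::ab_group_add \<Rightarrow> 'h" and Bh :: "'h set"
    and sm :: "'k \<Rightarrow> 'm::ab_group_add \<Rightarrow> 'm" and Bm :: "'m set"
    and br :: "'h \<Rightarrow> 'h \<Rightarrow> 'h" and \<rho> :: "'h \<Rightarrow> 'm \<Rightarrow> 'm"
    and G :: "'h \<times> 'm \<Rightarrow> 'h \<times> 'm \<Rightarrow> 'h \<times> 'm"
    and \<phi> :: "'h \<Rightarrow> 'm \<Rightarrow> 'h" and \<theta>h :: "'m \<Rightarrow> 'm \<Rightarrow> 'h" and \<theta>m :: "'m \<Rightarrow> 'm \<Rightarrow> 'm"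
  assumes fin_h: "finite_dimensional_vector_space sh Bh"
    and fin_m: "finite_dimensional_vector_space sm Bm"
    and lie: "lie_algebra sh br"
    and rep: "lie_representation sh br sm \<rho>"
    and theta_h: "alternating_bilinear sm sh \<theta>h"
    and theta_m: "alternating_bilinear sm sm \<theta>m"
    and phi: "\<phi> \<in> Z1 sh br (Hom_mod sm \<rho> sh br)"
    and G: "alternating_bilinear (module_prod.scale sh sm) (module_prod.scale sh sm) G"
    and G_hh: "\<And>h1 h2. G (h1, 0) (h2, 0) = (br h1 h2, 0)"
    and G_hm: "\<And>h u. G (h, 0) (0, u) = (\<phi> h u, \<rho> h u)"
    and G_mm: "\<And>u1 u2. G (0, u1) (0, u2) = (\<theta>h u1 u2, \<theta>m u1 u2)"
    and jacobi_hmm: "\<And>h u1 u2. jacobiator G (h, 0) (0, u1) (0, u2) = 0"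
  shows
    "delta \<rho> \<phi> = d0 (Alt2_mod sm \<rho> sm \<rho>) \<theta>m \<and>
     Qop \<phi> \<theta>m = d0 (Alt2_mod sm \<rho> sh br) \<theta>h \<and>
     (\<forall>\<phi>' \<in> coh_class (Hom_mod sm \<rho> sh br) \<phi>.
        coh_class (Alt2_mod sm \<rho> sm \<rho>) (delta \<rho> \<phi>') \<in> H1 sh br (Alt2_mod sm \<rho> sm \<rho>) \<and>
        coh_class (Alt2_mod sm \<rho> sm \<rho>) (delta \<rho> \<phi>') = coh_class (Alt2_mod sm \<rho> sm \<rho>) 0 \<and>
        (\<forall>\<theta>m' \<in> mod_space (Alt2_mod sm \<rho> sm \<rho>).
           delta \<rho> \<phi>' = d0 (Alt2_mod sm \<rho> sm \<rho>) \<theta>m' \<longrightarrow>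
             coh_class (Alt2_mod sm \<rho> sh br) (Qop \<phi>' \<theta>m') \<in> H1 sh br (Alt2_mod sm \<rho> sh br) \<and>
             coh_class (Alt2_mod sm \<rho> sh br) (Qop \<phi>' \<theta>m') \<in> Pi_sub sh br sm \<rho> \<phi>') \<and>
        (\<exists>\<theta>m' \<in> mod_space (Alt2_mod sm \<rho> sm \<rho>). \<exists>\<theta>h' \<in> mod_space (Alt2_mod sm \<rho> sh br).
           delta \<rho> \<phi>' = d0 (Alt2_mod sm \<rho> sm \<rho>) \<theta>m' \<and>
           Qop \<phi>' \<theta>m' = d0 (Alt2_mod sm \<rho> sh br) \<theta>h'))"
proof -
  interpret G: bracket_extension sh br sm \<rho> G \<phi>
    by (intro bracket_extension.intro bracket_extension_axioms.intro rep G phi G_hh G_hm jacobi_hmm)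
  have theta: "G.theta_h = \<theta>h" "G.theta_m = \<theta>m"
    by (simp_all add: G.theta_h_def G.theta_m_def G_mm fun_eq_iff)
  have "coh_class (Alt2_mod sm \<rho> sm \<rho>) (delta \<rho> \<phi>') \<in> H1 sh br (Alt2_mod sm \<rho> sm \<rho>) \<and>
      coh_class (Alt2_mod sm \<rho> sm \<rho>) (delta \<rho> \<phi>') = coh_class (Alt2_mod sm \<rho> sm \<rho>) 0 \<and>
      (\<forall>\<theta>m' \<in> mod_space (Alt2_mod sm \<rho> sm \<rho>).
         delta \<rho> \<phi>' = d0 (Alt2_mod sm \<rho> sm \<rho>) \<theta>m' \<longrightarrow>
           coh_class (Alt2_mod sm \<rho> sh br) (Qop \<phi>' \<theta>m') \<in> H1 sh br (Alt2_mod sm \<rho> sh br) \<and>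
           coh_class (Alt2_mod sm \<rho> sh br) (Qop \<phi>' \<theta>m') \<in> Pi_sub sh br sm \<rho> \<phi>') \<and>
      (\<exists>\<theta>m' \<in> mod_space (Alt2_mod sm \<rho> sm \<rho>). \<exists>\<theta>h' \<in> mod_space (Alt2_mod sm \<rho> sh br).
         delta \<rho> \<phi>' = d0 (Alt2_mod sm \<rho> sm \<rho>) \<theta>m' \<and>
         Qop \<phi>' \<theta>m' = d0 (Alt2_mod sm \<rho> sh br) \<theta>h')"
    if \<phi>'_class: "\<phi>' \<in> coh_class (Hom_mod sm \<rho> sh br) \<phi>" for \<phi>'
  proof -
    obtain \<sigma> where \<sigma>: "Vector_Spaces.linear sm sh \<sigma>"
      and \<phi>': "\<phi>' = \<phi> + d0 (Hom_mod sm \<rho> sh br) \<sigma>"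
      using \<phi>'_class by (auto simp: coh_class_def B1_def mod_space_Hom_mod)
    obtain G' where "bracket_extension sh br sm \<rho> G' \<phi>'"
      using G.change_of_complement[OF \<sigma>] unfolding \<phi>' by blast
    then interpret G': bracket_extension sh br sm \<rho> G' \<phi>' .
    have "G'.theta_m \<in> mod_space (Alt2_mod sm \<rho> sm \<rho>)" "G'.theta_h \<in> mod_space (Alt2_mod sm \<rho> sh br)"
      using G'.alternating_theta_m G'.alternating_theta_h by (simp_all add: Alt2_mod_def)
    then show ?thesis
      using G'.delta_class G'.Q_class G'.delta_eq_d_theta_m G'.Q_eq_d_theta_h by blast
  qed
  then show ?thesis
    using G.delta_eq_d_theta_m G.Q_eq_d_theta_h unfolding theta by blast
qed

end
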